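(* Let $G\colon\mathbb{R}^2\to\mathbb{R}^2$ be a $C^1$ map with $G(0,0)=(0,0)$. If $G$ is non-linear and unipotent, then there exists $\varepsilon>0$ such that the family of maps $$\big\{G_{\mu}(x,y)=G(x,y)-(\mu x,\mu y) : -\varepsilon<\mu<\varepsilon\big\}$$ satisfies the following two conditions: (a) for $0<\mu<\varepsilon$ the map $G_\mu$ has a global attractor at $(0,0)$, and for $-\varepsilon<\mu<0$ the map $G_\mu$ has a global repellor at $(0,0)$; (b) the map $G_\mu$ has no periodic points in $\mathbb{R}^2$ for $-\varepsilon<\mu<\varepsilon$.
   Context: A differentiable map $G\colon\mathbb{R}^2\to\mathbb{R}^2$ is called unipotent if its spectrum $\mathrm{Spc}(G)=\{\text{eigenvalues of } DG_z : z\in\mathbb{R}^2\}\subset\mathbb{C}$ is the set $\{1\}$. A subset $D\subset\mathbb{R}^2$ is a topological disc if it is homeomorphic to $\{z\in\mathbb{R}^2 : \|z\|\leq 1\}$. Let $F\colon\mathbb{R}^2\to\mathbb{R}^2$ be a topological embedding, i.e. a globally injective local homeomorphism. The $\omega$-limit set of $p\in\mathbb{R}^2$ is $\omega(p)=\{z\in\mathbb{R}^2 : \text{there are natural numbers } n_k\to\infty \text{ with } \lim_{k\to\infty}F^{n_k}(p)=z\}$. The origin is a local attractor for $F$ if there is a topological disc $D$, contained in the domain of $F$, which is a neighbourhood of $(0,0)$, such that $F(D)\subset\mathrm{Int}(D)$ and $\bigcap_{n=1}^\infty F^n(D)=\{(0,0)\}$. The origin is a global attractor for $F$ if it is a local attractor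 for $F$ and $\omega(p)=\{(0,0)\}$ for all $p\in\mathbb{R}^2$. If $F$ is a homeomorphism of $\mathbb{R}^2$ fixing $(0,0)$, then $(0,0)$ is a global repellor for $F$ if $(0,0)$ is a global attractor for $F^{-1}$. A point $(x,y)$ is a periodic point of a map $F$ if there is an integer $p>1$ such that $F^p(x,y)=(x,y)$ but $F^m(x,y)\neq(x,y)$ for all $1\leq m\leq p-1$ (so fixed points are not periodic points in this sense). *)

theory Defs
  imports "HOL-Analysis.Analysis"
begin

definition C1_map :: "(real^2 \<Rightarrow> real^2) \<Rightarrow> bool" where
  "C1_map G \<longleftrightarrow>
     (\<exists>G' :: real^2 \<Rightarrow> ((real^2) \<Rightarrow>\<^sub>L (real^2)).
        (\<forall>z. (G has_derivative blinfun_apply (G' z)) (at z)) \<and> continuous_on UNIV G')"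

text \<open>Eigenvalues of a real matrix are taken in the complex numbers.\<close>

definition complex_eigenvalue :: "real^'n^'n \<Rightarrow> complex \<Rightarrow> bool" where
  "complex_eigenvalue A c \<longleftrightarrow>
     (\<exists>v :: complex^'n. v \<noteq> 0 \<and> map_matrix complex_of_real A *v v = c *s v)"

text \<open>Only meaningful for \<open>G\<close> differentiable everywhere; \<open>jacobian\<close> is unspecified elsewhere.\<close>

definition Spc :: "(real^2 \<Rightarrow> real^2) \<Rightarrow> complex set" where
  "Spc G = {c. \<exists>z. complex_eigenvalue (jacobian G (at z)) c}"

definition unipotent :: "(real^2 \<Rightarrow> real^2) \<Rightarrow> bool" where
  "unipotent G \<longleftrightarrow> G differentiable_on UNIV \<and> Spc G = {1}"

definition topological_disc :: "(real^2) set \<Rightarrow> bool" where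
  "topological_disc D \<longleftrightarrow> D homeomorphic {z :: real^2. norm z \<le> 1}"

definition local_homeomorphism :: "(real^2 \<Rightarrow> real^2) \<Rightarrow> bool" where
  "local_homeomorphism F \<longleftrightarrow>
     (\<forall>z. \<exists>U. open U \<and> z \<in> U \<and> open (F ` U) \<and> (\<exists>g. homeomorphism U (F ` U) F g))"

definition topological_embedding :: "(real^2 \<Rightarrow> real^2) \<Rightarrow> bool" where
  "topological_embedding F \<longleftrightarrow> inj F \<and> local_homeomorphism F"

definition omega_limit :: "(real^2 \<Rightarrow> real^2) \<Rightarrow> real^2 \<Rightarrow> (real^2) set" where
  "omega_limit F p =
     {z. \<exists>n :: nat \<Rightarrow> nat. filterlim n at_top sequentially \<and> (\<lambda>k. (F ^^ n k) p) \<longlonglongrightarrow> z}"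

text \<open>Attractors are only defined for topological embeddings, so being one is part of the
  definition.\<close>

definition local_attractor :: "(real^2 \<Rightarrow> real^2) \<Rightarrow> bool" where
  "local_attractor F \<longleftrightarrow> topological_embedding F \<and>
     (\<exists>D. topological_disc D \<and> 0 \<in> interior D \<and> F ` D \<subseteq> interior D \<and>
          (\<Inter>n\<in>{1..}. (F ^^ n) ` D) = {0})"

definition global_attractor :: "(real^2 \<Rightarrow> real^2) \<Rightarrow> bool" where
  "global_attractor F \<longleftrightarrow> local_attractor F \<and> (\<forall>p. omega_limit F p = {0})"

definition global_repellor :: "(real^2 \<Rightarrow> real^2) \<Rightarrow> bool" where
  "global_repellor F \<longleftrightarrow>
     homeomorphism UNIV UNIV F (inv F) \<and> F 0 = 0 \<and> global_attractor (inv F)"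

text \<open>The period is required to exceed 1: fixed points do not count as periodic.\<close>

definition periodic_point :: "(real^2 \<Rightarrow> real^2) \<Rightarrow> real^2 \<Rightarrow> bool" where
  "periodic_point F z \<longleftrightarrow>
     (\<exists>p>1. (F ^^ p) z = z \<and> (\<forall>m. 1 \<le> m \<and> m \<le> p - 1 \<longrightarrow> (F ^^ m) z \<noteq> z))"

end

theory Submission
  imports Defs
begin

text \<open>
  A \<open>C\<^sup>1\<close> unipotent map \<open>G\<close> of the plane with \<open>G 0 = 0\<close> is a shear: in a suitable orthonormal basis
  \<open>u, v\<close> it has the form \<open>G z = z + \<phi> (u \<bullet> z) v\<close> with \<open>\<phi>\<close> of class \<open>C\<^sup>1\<close> and \<open>\<phi> 0 = 0\<close>
  (\<open>unipotent_normal_form\<close>). Hence \<open>G z - \<mu> z = (1 - \<mu>) z + \<phi> (u \<bullet> z) v\<close>, whose dynamics can be read off: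
  the \<open>u\<close>-coordinate is multiplied by \<open>\<kappa> = 1 - \<mu>\<close>, and the \<open>v\<close>-coordinate by \<open>\<kappa>\<close> up to an error
  \<open>\<phi> (u \<bullet> z) = O (u \<bullet> z)\<close>. For \<open>0 < \<kappa> < 1\<close> the map contracts, on every strip around the \<open>v\<close>-axis, a norm
  that weights the \<open>u\<close>-coordinate heavily enough (\<open>shear_contracts\<close>), which gives the global attractor. For
  \<open>\<kappa> > 1\<close> the inverse is a map of the same form with factor \<open>1 / \<kappa>\<close>, which gives the global
  repellor. Periodic points are excluded by looking at the \<open>u\<close>-coordinate first. All of this works for
  \<open>\<bar>\<mu>\<bar> < 1\<close>, so \<open>\<epsilon> = 1\<close>.

  The normal form is a version of the theorem of Hartman and Nirenberg that a surface of zero curvature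
  that is a graph over the whole plane is a cylinder. The derivative of \<open>H = G - id\<close> is nilpotent. Where it
  is not zero, a component of \<open>H\<close> has straight level curves, and the reciprocal of one of its partial
  derivatives is an affine function along such a line (\<open>local_line\<close>). So the derivative of \<open>H\<close> cannot
  reach zero at a finite point of the line, and the whole line lies in the set where the derivative is
  nonzero (\<open>full_line\<close>). Two such lines cannot cross, because at the crossing point the derivative would
  annihilate two independent directions. So they are all parallel (\<open>common_kernel\<close>), and their
  direction \<open>v\<close> is annihilated by the derivative of \<open>H\<close> everywhere.
\<close>

section \<open>Planar maps with nilpotent derivative\<close>

text \<open>The map is written in coordinates as \<open>(a, b)\<close>, and \<open>a1\<close>, \<open>a2\<close>, \<open>b1\<close>, \<open>b2\<close> are its continuous
  partial derivatives. Trace and determinant zero say that the Jacobian matrix is nilpotent; it then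
  vanishes exactly where \<open>a2\<close> and \<open>b1\<close> both do.\<close>

locale planar_nilpotent =
  fixes a b a1 a2 b1 b2 :: "real \<times> real \<Rightarrow> real"
  assumes deriv_a: "\<And>z. (a has_derivative (\<lambda>w. a1 z * fst w + a2 z * snd w)) (at z)"
    and deriv_b: "\<And>z. (b has_derivative (\<lambda>w. b1 z * fst w + b2 z * snd w)) (at z)"
    and cont_a1: "continuous_on UNIV a1" and cont_a2: "continuous_on UNIV a2"
    and cont_b1: "continuous_on UNIV b1" and cont_b2: "continuous_on UNIV b2"
    and trace: "\<And>z. a1 z + b2 z = 0"
    and det: "\<And>z. a1 z * b2 z - a2 z * b1 z = 0"
begin

lemma a_chain:
  assumes "(X has_real_derivative x') (at t)" "(Y has_real_derivative y') (at t)"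
  shows "((\<lambda>t. a (X t, Y t)) has_real_derivative (a1 (X t, Y t) * x' + a2 (X t, Y t) * y')) (at t)"
proof -
  have "((\<lambda>t. (X t, Y t)) has_derivative (\<lambda>h. (x' * h, y' * h))) (at t)"
    using assms by (auto simp: has_field_derivative_def intro!: has_derivative_Pair)
  from has_derivative_compose[OF this deriv_a]
  show ?thesis
    unfolding has_field_derivative_def by (rule has_derivative_eq_rhs) (simp add: fun_eq_iff algebra_simps)
qed

lemma b_chain:
  assumes "(X has_real_derivative x') (at t)" "(Y has_real_derivative y') (at t)"
  shows "((\<lambda>t. b (X t, Y t)) has_real_derivative (b1 (X t, Y t) * x' + b2 (X t, Y t) * y')) (at t)"
proof -
  have "((\<lambda>t. (X t, Y t)) has_derivative (\<lambda>h. (x' * h, y' * h))) (at t)"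
    using assms by (auto simp: has_field_derivative_def intro!: has_derivative_Pair)
  from has_derivative_compose[OF this deriv_b]
  show ?thesis
    unfolding has_field_derivative_def by (rule has_derivative_eq_rhs) (simp add: fun_eq_iff algebra_simps)
qed

text \<open>Where \<open>a2 \<noteq> 0\<close>, the map \<open>(x, y) \<mapsto> (x, a (x, y))\<close> is a local diffeomorphism. The second component
  \<open>Y x \<alpha>\<close> of its inverse describes the level curves of \<open>a\<close> as graphs over the \<open>x\<close>-axis, with the
  level \<open>\<alpha>\<close> as a differentiable parameter.\<close>

lemma level_chart:
  assumes "a2 (x0, y0) \<noteq> 0"
  obtains r Y where "r > 0"
    and "\<And>x \<alpha>. \<lbrakk>\<bar>x - x0\<bar> < r; \<bar>\<alpha> - a (x0, y0)\<bar> < r\<rbrakk> \<Longrightarrow> a2 (x, Y x \<alpha>) \<noteq> 0"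
    and "\<And>x \<alpha>. \<lbrakk>\<bar>x - x0\<bar> < r; \<bar>\<alpha> - a (x0, y0)\<bar> < r\<rbrakk> \<Longrightarrow> a (x, Y x \<alpha>) = \<alpha>"
    and "\<And>x \<alpha>. \<lbrakk>\<bar>x - x0\<bar> < r; \<bar>\<alpha> - a (x0, y0)\<bar> < r\<rbrakk> \<Longrightarrow>
           ((\<lambda>x. Y x \<alpha>) has_real_derivative - a1 (x, Y x \<alpha>) / a2 (x, Y x \<alpha>)) (at x)"
    and "\<And>x \<alpha>. \<lbrakk>\<bar>x - x0\<bar> < r; \<bar>\<alpha> - a (x0, y0)\<bar> < r\<rbrakk> \<Longrightarrow>
           ((\<lambda>\<alpha>. Y x \<alpha>) has_real_derivative 1 / a2 (x, Y x \<alpha>)) (at \<alpha>)"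
    and "Y x0 (a (x0, y0)) = y0"
proof -
  define C0 C1 C2 :: "(real \<times> real) \<Rightarrow>\<^sub>L (real \<times> real)"
    where "C0 = Blinfun (\<lambda>w. (fst w, 0))" and "C1 = Blinfun (\<lambda>w. (0, fst w))"
      and "C2 = Blinfun (\<lambda>w. (0, snd w))"
  have [simp]: "blinfun_apply C0 w = (fst w, 0)" "blinfun_apply C1 w = (0, fst w)"
    "blinfun_apply C2 w = (0, snd w)" for w
    unfolding C0_def C1_def C2_def
    by (subst bounded_linear_Blinfun_apply;
        auto intro!: bounded_linear_Pair bounded_linear_fst bounded_linear_snd bounded_linear_zero)+
  define U where "U = {z. a2 z \<noteq> 0}"
  define f where "f z = (fst z, a z)" for z
  define f' where "f' z = C0 + a1 z *\<^sub>R C1 + a2 z *\<^sub>R C2" for z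
  have f'_apply: "blinfun_apply (f' z) w = (fst w, a1 z * fst w + a2 z * snd w)" for z w
    by (simp add: f'_def blinfun.add_left blinfun.scaleR_left)
  \<comment> \<open>The inverse matrix of the derivative of \<open>f\<close> at the base point.\<close>
  define J where "J = C0 - (a1 (x0,y0) / a2 (x0,y0)) *\<^sub>R C1 + (1 / a2 (x0,y0)) *\<^sub>R C2"
  have "open U"
    unfolding U_def by (intro open_Collect_neq cont_a2 continuous_on_const)
  moreover have "(f has_derivative blinfun_apply (f' z)) (at z)" for z
    unfolding f_def f'_apply[abs_def]
    by (intro has_derivative_Pair has_derivative_fst[OF has_derivative_ident] deriv_a)
  moreover have "continuous_on U f'"
    unfolding f'_def
    by (intro continuous_intros continuous_on_subset[OF cont_a1] continuous_on_subset[OF cont_a2]) auto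
  moreover have "(x0, y0) \<in> U" using assms by (simp add: U_def)
  moreover have "J o\<^sub>L f' (x0, y0) = id_blinfun"
    using assms
    by (intro blinfun_eqI)
       (auto simp: J_def f'_apply blinfun.add_left blinfun.diff_left blinfun.scaleR_left prod_eq_iff field_simps)
  ultimately obtain U' V g g' where UV: "open U'" "U' \<subseteq> U" "(x0,y0) \<in> U'" "open V" "f (x0,y0) \<in> V"
    and hom: "homeomorphism U' V f g"
    and g1: "\<And>y. y \<in> V \<Longrightarrow> (g has_derivative (g' y)) (at y)"
    and g2: "\<And>y. y \<in> V \<Longrightarrow> g' y = inv (blinfun_apply (f' (g y)))"
    and g3: "\<And>y. y \<in> V \<Longrightarrow> bij (blinfun_apply (f' (g y)))"
    using inverse_function_theorem[of U f f' "(x0,y0)" J] by metis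
  define Y where "Y x \<alpha> = snd (g (x, \<alpha>))" for x \<alpha>
  obtain e where e: "e > 0" "ball (f (x0,y0)) e \<subseteq> V"
    using UV openE by blast
  have inV: "(x, \<alpha>) \<in> V" if "\<bar>x - x0\<bar> < e/2" "\<bar>\<alpha> - a (x0, y0)\<bar> < e/2" for x \<alpha>
  proof -
    have "dist (x, \<alpha>) (x0, a (x0, y0)) \<le> \<bar>x - x0\<bar> + \<bar>\<alpha> - a (x0, y0)\<bar>"
      unfolding dist_Pair_Pair dist_real_def using sqrt_sum_squares_le_sum_abs by simp
    then show ?thesis using that e by (auto simp: f_def dist_commute)
  qed
  have g_eq: "g (x, \<alpha>) = (x, Y x \<alpha>)" and a_eq: "a (x, Y x \<alpha>) = \<alpha>" and nz: "a2 (x, Y x \<alpha>) \<noteq> 0"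
    if "(x, \<alpha>) \<in> V" for x \<alpha>
  proof -
    have "f (g (x, \<alpha>)) = (x, \<alpha>)" "g (x, \<alpha>) \<in> U'"
      using hom that by (auto simp: homeomorphism_def)
    moreover from this show g: "g (x, \<alpha>) = (x, Y x \<alpha>)"
      by (simp add: f_def Y_def prod_eq_iff)
    ultimately show "a (x, Y x \<alpha>) = \<alpha>" "a2 (x, Y x \<alpha>) \<noteq> 0"
      using UV(2) by (auto simp: f_def U_def)
  qed
  have g'_apply: "g' (x, \<alpha>) w = (fst w, (snd w - a1 (x, Y x \<alpha>) * fst w) / a2 (x, Y x \<alpha>))"
    if V: "(x, \<alpha>) \<in> V" for x \<alpha> w
  proof -
    have "blinfun_apply (f' (x, Y x \<alpha>)) (fst w, (snd w - a1 (x, Y x \<alpha>) * fst w) / a2 (x, Y x \<alpha>)) = w"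
      using nz[OF V] by (simp add: f'_apply prod_eq_iff)
    moreover have "bij (blinfun_apply (f' (x, Y x \<alpha>)))" using g3[OF V] g_eq[OF V] by simp
    ultimately show ?thesis unfolding g2[OF V] g_eq[OF V]
      by (metis bij_inv_eq_iff)
  qed
  have dg: "((\<lambda>t. Y (X t) (A t)) has_derivative
        (\<lambda>h. (\<alpha>' * h - a1 (X t, Y (X t) (A t)) * (x' * h)) / a2 (X t, Y (X t) (A t)))) (at t)"
    if V: "(X t, A t) \<in> V" and "(X has_real_derivative x') (at t)" "(A has_real_derivative \<alpha>') (at t)"
    for X A t x' \<alpha>'
  proof -
    have "((\<lambda>t. (X t, A t)) has_derivative (\<lambda>h. (x' * h, \<alpha>' * h))) (at t)"
      using that by (auto simp: has_field_derivative_def intro!: has_derivative_Pair)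
    from has_derivative_snd[OF has_derivative_compose[OF this g1[OF V]]]
    show ?thesis by (simp add: g'_apply[OF V] Y_def)
  qed
  show thesis
  proof (rule that[of "e/2" Y])
    have "g (f (x0,y0)) = (x0,y0)" using hom UV by (auto simp: homeomorphism_def)
    then show "Y x0 (a (x0, y0)) = y0" by (simp add: Y_def f_def)
  next
    fix x \<alpha> assume "\<bar>x - x0\<bar> < e/2" "\<bar>\<alpha> - a (x0, y0)\<bar> < e/2"
    then have V: "(x, \<alpha>) \<in> V" by (rule inV)
    show "((\<lambda>x. Y x \<alpha>) has_real_derivative - a1 (x, Y x \<alpha>) / a2 (x, Y x \<alpha>)) (at x)"
      unfolding has_field_derivative_def
      by (rule has_derivative_eq_rhs[OF dg[of "\<lambda>x. x" x "\<lambda>_. \<alpha>" 1 0]])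
         (use V in \<open>simp_all add: fun_eq_iff\<close>)
    show "((\<lambda>\<alpha>. Y x \<alpha>) has_real_derivative 1 / a2 (x, Y x \<alpha>)) (at \<alpha>)"
      unfolding has_field_derivative_def
      by (rule has_derivative_eq_rhs[OF dg[of "\<lambda>_. x" \<alpha> "\<lambda>\<alpha>. \<alpha>" 0 1]])
         (use V in \<open>simp_all add: fun_eq_iff\<close>)
  qed (use e inV a_eq nz in auto)
qed

text \<open>The level curves are straight because their slope depends on the level alone. Vanishing of the
  determinant makes \<open>b\<close> constant on the level curves of \<open>a\<close>, so \<open>b = h \<circ> a\<close> and \<open>b2 / a2 = h' \<circ> a\<close>; by
  the trace condition the slope \<open>- a1 / a2\<close> is this same quotient.

  The last conclusion is what prevents \<open>a2\<close> from dying out along the line. The chart is affine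
  in \<open>x\<close>, that is \<open>Y x \<alpha> = Y x0 \<alpha> + s \<alpha> * (x - x0)\<close>, so \<open>s\<close> is a difference quotient of two
  differentiable functions of \<open>\<alpha>\<close>, hence differentiable although the map is only \<open>C\<^sup>1\<close>. Differentiating
  in \<open>\<alpha>\<close> shows that \<open>1 / a2\<close>, which is the \<open>\<alpha>\<close>-derivative of \<open>Y\<close>, is affine in \<open>x\<close>.\<close>

lemma local_line:
  assumes "a2 (x0, y0) \<noteq> 0"
  defines "\<sigma> \<equiv> - a1 (x0, y0) / a2 (x0, y0)"
  obtains r A B where "r > 0"
    and "\<And>x. \<bar>x - x0\<bar> < r \<Longrightarrow> a (x, y0 + \<sigma> * (x - x0)) = a (x0, y0)"
    and "\<And>x. \<bar>x - x0\<bar> < r \<Longrightarrow> a2 (x, y0 + \<sigma> * (x - x0)) * (A + B * x) = 1"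
proof -
  define \<alpha>0 where "\<alpha>0 = a (x0, y0)"
  obtain r Y where r: "r > 0"
    and nz: "\<And>x \<alpha>. \<lbrakk>\<bar>x - x0\<bar> < r; \<bar>\<alpha> - \<alpha>0\<bar> < r\<rbrakk> \<Longrightarrow> a2 (x, Y x \<alpha>) \<noteq> 0"
    and aY: "\<And>x \<alpha>. \<lbrakk>\<bar>x - x0\<bar> < r; \<bar>\<alpha> - \<alpha>0\<bar> < r\<rbrakk> \<Longrightarrow> a (x, Y x \<alpha>) = \<alpha>"
    and Yx: "\<And>x \<alpha>. \<lbrakk>\<bar>x - x0\<bar> < r; \<bar>\<alpha> - \<alpha>0\<bar> < r\<rbrakk> \<Longrightarrow>
           ((\<lambda>x. Y x \<alpha>) has_real_derivative - a1 (x, Y x \<alpha>) / a2 (x, Y x \<alpha>)) (at x)"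
    and Ya: "\<And>x \<alpha>. \<lbrakk>\<bar>x - x0\<bar> < r; \<bar>\<alpha> - \<alpha>0\<bar> < r\<rbrakk> \<Longrightarrow>
           ((\<lambda>\<alpha>. Y x \<alpha>) has_real_derivative 1 / a2 (x, Y x \<alpha>)) (at \<alpha>)"
    and Y0: "Y x0 \<alpha>0 = y0"
    by (rule level_chart[OF assms(1), folded \<alpha>0_def]) (rule that; assumption)
  define I where "I = {x. \<bar>x - x0\<bar> < r}"
  define K where "K = {\<alpha>. \<bar>\<alpha> - \<alpha>0\<bar> < r}"
  have I: "convex I" "x0 \<in> I" and K: "open K" "\<alpha>0 \<in> K"
  proof -
    have "I = ball x0 r" "K = ball \<alpha>0 r" by (auto simp: I_def K_def dist_real_def)
    then show "convex I" "x0 \<in> I" "open K" "\<alpha>0 \<in> K" using r by auto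
  qed
  have nz: "a2 (x, Y x \<alpha>) \<noteq> 0" and aY: "a (x, Y x \<alpha>) = \<alpha>"
    and Yx: "((\<lambda>x. Y x \<alpha>) has_real_derivative - a1 (x, Y x \<alpha>) / a2 (x, Y x \<alpha>)) (at x)"
    and Ya: "((\<lambda>\<alpha>. Y x \<alpha>) has_real_derivative 1 / a2 (x, Y x \<alpha>)) (at \<alpha>)"
    if "x \<in> I" "\<alpha> \<in> K" for x \<alpha>
    using that nz aY Yx Ya by (auto simp: I_def K_def)
  have b_const: "b (x, Y x \<alpha>) = b (x0, Y x0 \<alpha>)" if "x \<in> I" "\<alpha> \<in> K" for x \<alpha>
  proof -
    have "\<exists>c. \<forall>x\<in>I. b (x, Y x \<alpha>) = c"
    proof (rule has_field_derivative_zero_constant[OF I(1)])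
      fix x assume x: "x \<in> I"
      have "b1 (x, Y x \<alpha>) * 1 + b2 (x, Y x \<alpha>) * (- a1 (x, Y x \<alpha>) / a2 (x, Y x \<alpha>)) = 0"
        using nz[OF x \<open>\<alpha> \<in> K\<close>] det[of "(x, Y x \<alpha>)"] by (simp add: field_simps)
      with b_chain[OF DERIV_ident Yx[OF x \<open>\<alpha> \<in> K\<close>]]
      show "((\<lambda>x. b (x, Y x \<alpha>)) has_field_derivative 0) (at x within I)"
        by (metis has_field_derivative_at_within)
    qed
    then show ?thesis using that I(2) by metis
  qed
  \<comment> \<open>This is \<open>h' \<alpha>\<close> for the function \<open>h\<close> with \<open>b = h \<circ> a\<close>, and it is the slope of the level curve.\<close>
  define s where "s \<alpha> = b2 (x0, Y x0 \<alpha>) / a2 (x0, Y x0 \<alpha>)" for \<alpha>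
  have ratio: "b2 (x, Y x \<alpha>) / a2 (x, Y x \<alpha>) = s \<alpha>" if x: "x \<in> I" and \<alpha>: "\<alpha> \<in> K" for x \<alpha>
  proof -
    have 1: "((\<lambda>\<alpha>. b (x, Y x \<alpha>)) has_real_derivative b2 (x, Y x \<alpha>) / a2 (x, Y x \<alpha>)) (at \<alpha>)"
      if "x \<in> I" for x
      using b_chain[OF DERIV_const Ya[OF that \<alpha>]] by simp
    have "((\<lambda>\<alpha>. b (x0, Y x0 \<alpha>)) has_real_derivative b2 (x, Y x \<alpha>) / a2 (x, Y x \<alpha>)) (at \<alpha>)"
      by (rule has_field_derivative_transform_within_open[OF 1[OF x] K(1) \<alpha>]) (simp add: b_const x)
    from DERIV_unique[OF this 1[OF I(2)]] show ?thesis by (simp add: s_def)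
  qed
  have Y_affine: "Y x \<alpha> = Y x0 \<alpha> + s \<alpha> * (x - x0)" if "x \<in> I" and \<alpha>: "\<alpha> \<in> K" for x \<alpha>
  proof -
    have "\<exists>c. \<forall>x\<in>I. Y x \<alpha> - s \<alpha> * (x - x0) = c"
    proof (rule has_field_derivative_zero_constant[OF I(1)])
      fix x assume x: "x \<in> I"
      have "a1 (x, Y x \<alpha>) = - b2 (x, Y x \<alpha>)" using trace[of "(x, Y x \<alpha>)"] by simp
      then have "((\<lambda>x. Y x \<alpha>) has_real_derivative s \<alpha>) (at x)"
        using Yx[OF x \<alpha>] ratio[OF x \<alpha>] by simp
      then have "((\<lambda>x. Y x \<alpha> - s \<alpha> * (x - x0)) has_field_derivative 0) (at x)"
        by (auto intro!: derivative_eq_intros)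
      then show "((\<lambda>x. Y x \<alpha> - s \<alpha> * (x - x0)) has_field_derivative 0) (at x within I)"
        by (rule has_field_derivative_at_within)
    qed
    then obtain c where "\<forall>x\<in>I. Y x \<alpha> - s \<alpha> * (x - x0) = c" by blast
    from this[rule_format, OF \<open>x \<in> I\<close>] this[rule_format, OF I(2)]
    show ?thesis by simp
  qed
  have s0: "s \<alpha>0 = \<sigma>"
    using trace[of "(x0,y0)"] by (simp add: s_def \<sigma>_def Y0 add_eq_0_iff)
  have line: "Y x \<alpha>0 = y0 + \<sigma> * (x - x0)" if "x \<in> I" for x
    using Y_affine[OF that K(2)] by (simp add: s0 Y0)
  \<comment> \<open>Along the line, \<open>m\<close> is the derivative of the chart with respect to the level.\<close>
  define m where "m x = 1 / a2 (x, Y x \<alpha>0)" for x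
  \<comment> \<open>Any second abscissa in the chart serves to express \<open>s\<close> by values of \<open>Y\<close>.\<close>
  define x1 where "x1 = x0 + r/2"
  have x1: "x1 \<in> I" "x1 - x0 \<noteq> 0" using r by (auto simp: x1_def I_def)
  define B where "B = (m x1 - m x0) / (x1 - x0)"
  have dY: "((\<lambda>\<alpha>. Y x \<alpha>) has_real_derivative m x) (at \<alpha>0)" if "x \<in> I" for x
    using Ya[OF that K(2)] by (simp add: m_def)
  have ds: "(s has_real_derivative B) (at \<alpha>0)"
  proof (rule has_field_derivative_transform_within_open[OF _ K])
    show "((\<lambda>\<alpha>. (Y x1 \<alpha> - Y x0 \<alpha>) / (x1 - x0)) has_field_derivative B) (at \<alpha>0)"
      unfolding B_def by (intro DERIV_cdivide DERIV_diff dY x1 I)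
    show "(Y x1 \<alpha> - Y x0 \<alpha>) / (x1 - x0) = s \<alpha>" if "\<alpha> \<in> K" for \<alpha>
      using Y_affine[OF x1(1) that] x1(2) by simp
  qed
  have m_affine: "m x = m x0 + B * (x - x0)" if x: "x \<in> I" for x
  proof -
    have 1: "((\<lambda>\<alpha>. Y x0 \<alpha> + s \<alpha> * (x - x0)) has_real_derivative m x0 + B * (x - x0)) (at \<alpha>0)"
      by (intro DERIV_add DERIV_cmult_right dY[OF I(2)] ds)
    have "((\<lambda>\<alpha>. Y x \<alpha>) has_real_derivative m x0 + B * (x - x0)) (at \<alpha>0)"
      by (rule has_field_derivative_transform_within_open[OF 1 K]) (simp add: Y_affine x)
    from DERIV_unique[OF dY[OF x] this] show ?thesis .
  qed
  show thesis
  proof (rule that[of r "m x0 - B * x0" B])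
    fix x assume "\<bar>x - x0\<bar> < r"
    then have x: "x \<in> I" by (simp add: I_def)
    show "a (x, y0 + \<sigma> * (x - x0)) = a (x0, y0)"
      using aY[OF x K(2)] line[OF x] by (simp add: \<alpha>0_def)
    have "m x0 - B * x0 + B * x = m x" using m_affine[OF x] by (simp add: algebra_simps)
    then show "a2 (x, y0 + \<sigma> * (x - x0)) * (m x0 - B * x0 + B * x) = 1"
      using nz[OF x K(2)] line[OF x] by (simp add: m_def)
  qed (rule r)
qed

text \<open>The local segment extends to the whole line by connectedness of the real axis. Up to a boundary
  point of the part already covered, the equation \<open>a2 * (A + B * x) = 1\<close> persists by continuity, so
  \<open>a2\<close> does not vanish there and the local result applies again. Both descriptions of \<open>1 / a2\<close> are affine
  and agree on an interval, hence they are the same.\<close>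

lemma full_line:
  assumes "a2 (x0, y0) \<noteq> 0"
  defines "\<sigma> \<equiv> - a1 (x0, y0) / a2 (x0, y0)"
  shows "a2 (x, y0 + \<sigma> * (x - x0)) \<noteq> 0"
    and "a1 (x, y0 + \<sigma> * (x - x0)) + a2 (x, y0 + \<sigma> * (x - x0)) * \<sigma> = 0"
proof -
  define L where "L x = (x, y0 + \<sigma> * (x - x0))" for x
  have L0: "L x0 = (x0, y0)" by (simp add: L_def)
  obtain r A B where r: "r > 0" and near:
    "\<And>x. \<bar>x - x0\<bar> < r \<Longrightarrow> a (L x) = a (L x0)"
    "\<And>x. \<bar>x - x0\<bar> < r \<Longrightarrow> a2 (L x) * (A + B * x) = 1"
    by (rule local_line[OF assms(1), folded \<sigma>_def, folded L_def, folded L0]) (rule that; assumption)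
  define P where "P x \<longleftrightarrow> a (L x) = a (L x0) \<and> a2 (L x) * (A + B * x) = 1" for x
  \<comment> \<open>Points near which the line lies in the level set; the interior makes tangency available on \<open>E\<close>.\<close>
  define E where "E = interior {x. P x}"
  have "open E" and E_P: "\<And>x. x \<in> E \<Longrightarrow> P x"
    using interior_subset[of "{x. P x}"] by (auto simp: E_def)
  have contL: "continuous_on UNIV L"
    unfolding L_def by (intro continuous_intros)
  have cont: "continuous_on UNIV (\<lambda>x. a (L x))" "continuous_on UNIV (\<lambda>x. a1 (L x))"
      "continuous_on UNIV (\<lambda>x. a2 (L x))"
    by (rule continuous_on_compose2[OF _ contL subset_UNIV],
        fact cont_a1 cont_a2 has_derivative_continuous_on[OF deriv_a[THEN has_derivative_at_withinI]])+
  have dL: "((\<lambda>x. a (L x)) has_real_derivative a1 (L x) + a2 (L x) * \<sigma>) (at x)" for x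
  proof -
    have "((\<lambda>x. y0 + \<sigma> * (x - x0)) has_real_derivative \<sigma>) (at x)"
      by (auto intro!: derivative_eq_intros)
    from a_chain[OF DERIV_ident this] show ?thesis by (simp add: L_def)
  qed
  have tangent_E: "a1 (L x) + a2 (L x) * \<sigma> = 0" if x: "x \<in> E" for x
  proof -
    have "((\<lambda>x. a (L x)) has_real_derivative 0) (at x)"
      by (rule has_field_derivative_transform_within_open[OF DERIV_const[of "a (L x0)"] \<open>open E\<close> x])
         (use E_P in \<open>auto simp: P_def\<close>)
    from DERIV_unique[OF dL this] show ?thesis .
  qed
  have "closed E"
  proof (rule closure_subset_eq[THEN iffD1], rule subsetI)
    fix X assume X: "X \<in> closure E"
    have "closed {x. P x}"
      unfolding P_def by (intro closed_Collect_conj closed_Collect_eq cont continuous_intros)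
    then have "closure E \<subseteq> {x. P x}" by (intro closure_minimal) (use E_P in auto)
    then have PX: "P X" using X by auto
    have "closure E \<subseteq> {x. a1 (L x) + a2 (L x) * \<sigma> = 0}"
      by (intro closure_minimal closed_Collect_eq cont continuous_intros) (use tangent_E in auto)
    then have TX: "a1 (L X) + a2 (L X) * \<sigma> = 0" using X by auto
    have nz: "a2 (L X) \<noteq> 0" using PX by (auto simp: P_def)
    \<comment> \<open>The level segment through the boundary point therefore lies on the same line.\<close>
    then have slope: "- a1 (L X) / a2 (L X) = \<sigma>" using TX by (simp add: field_simps)
    have line: "(x, (y0 + \<sigma> * (X - x0)) + \<sigma> * (x - X)) = L x" for x
      by (simp add: L_def algebra_simps)
    obtain r' A' B' where r': "r' > 0" and near':
      "\<And>x. \<bar>x - X\<bar> < r' \<Longrightarrow> a (L x) = a (L X)"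
      "\<And>x. \<bar>x - X\<bar> < r' \<Longrightarrow> a2 (L x) * (A' + B' * x) = 1"
      by (rule local_line[OF nz[unfolded L_def], folded L_def, unfolded slope line]) (rule that; assumption)
    obtain w where "w \<in> E" "dist w X < r'" using X r' closure_approachable by blast
    then have w: "w \<in> E \<inter> ball X r'" by (simp add: dist_commute)
    have "open (E \<inter> ball X r')" using \<open>open E\<close> by auto
    with w obtain d where d: "d > 0" "cball w d \<subseteq> E \<inter> ball X r'"
      by (meson open_contains_cball)
    have agree: "A + B * x = A' + B' * x" if "x \<in> cball w d" for x
    proof -
      have "P x" using that d E_P by blast
      moreover have "\<bar>x - X\<bar> < r'" using that d by (force simp: dist_real_def)
      ultimately have "a2 (L x) * (A + B * x) = a2 (L x) * (A' + B' * x)" "a2 (L x) \<noteq> 0"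
        using near'(2) by (auto simp: P_def)
      then show ?thesis by simp
    qed
    have "A + B * w = A' + B' * w" "A + B * (w + d) = A' + B' * (w + d)"
      using d(1) by (auto intro!: agree simp: dist_real_def)
    then have "B * d = B' * d" unfolding distrib_left by linarith
    then have "B = B'" using d(1) by simp
    then have "A = A'" using \<open>A + B * w = A' + B' * w\<close> by simp
    have "P x" if "x \<in> ball X r'" for x
      using near'[of x] that PX unfolding P_def \<open>A = A'\<close> \<open>B = B'\<close>
      by (simp add: dist_real_def abs_minus_commute)
    then show "X \<in> E"
      unfolding E_def by (intro interiorI[of "ball X r'"]) (use r' in auto)
  qed
  moreover have "x0 \<in> E"
  proof -
    have "P x" if "x \<in> ball x0 r" for x
      using near[of x] that by (simp add: P_def dist_real_def abs_minus_commute)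
    then show ?thesis
      unfolding E_def by (intro interiorI[of "ball x0 r"]) (use r in auto)
  qed
  ultimately have "E = UNIV" using \<open>open E\<close> clopen by blast
  then have x: "x \<in> E" by simp
  then have "P x" by (rule E_P)
  with tangent_E[OF x] show "a2 (x, y0 + \<sigma> * (x - x0)) \<noteq> 0"
    and "a1 (x, y0 + \<sigma> * (x - x0)) + a2 (x, y0 + \<sigma> * (x - x0)) * \<sigma> = 0"
    by (auto simp: P_def L_def)
qed

text \<open>Since the Jacobian matrix is nilpotent, the disjunction says that it is nonzero. It is required along
  the whole line because two lines are to be compared at their point of intersection.\<close>

definition kernel_line :: "real \<times> real \<Rightarrow> real \<times> real \<Rightarrow> bool" where
  "kernel_line p v \<longleftrightarrow> v \<noteq> 0 \<and>
     (\<forall>t. let q = p + t *\<^sub>R v in (a2 q \<noteq> 0 \<or> b1 q \<noteq> 0) \<and>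
        a1 q * fst v + a2 q * snd v = 0 \<and> b1 q * fst v + b2 q * snd v = 0)"

lemma kernel_line_if_a2:
  assumes "a2 p \<noteq> 0"
  shows "kernel_line p (1, - a1 p / a2 p)"
proof -
  obtain x0 y0 where p: "p = (x0, y0)" by (cases p)
  define \<sigma> where "\<sigma> = - a1 p / a2 p"
  have 1: "a2 q \<noteq> 0" "a1 q + a2 q * \<sigma> = 0" if "q = p + t *\<^sub>R (1, \<sigma>)" for q t
    using full_line[of x0 y0 "x0 + t"] assms that unfolding p \<sigma>_def by (simp_all add: mult.commute)
  have 2: "b1 q + b2 q * \<sigma> = 0" if "q = p + t *\<^sub>R (1, \<sigma>)" for q t
  proof -
    have "a2 q * (b1 q + b2 q * \<sigma>) = a1 q * b2 q + b2 q * (a2 q * \<sigma>)"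
      using det[of q] by (simp add: algebra_simps)
    also have "\<dots> = b2 q * (a1 q + a2 q * \<sigma>)" by (simp add: algebra_simps)
    finally show ?thesis using 1[OF that] by simp
  qed
  have "kernel_line p (1, \<sigma>)"
    unfolding kernel_line_def Let_def using 1[OF refl] 2[OF refl] by (simp add: zero_prod_def)
  then show ?thesis by (simp only: \<sigma>_def)
qed

end

text \<open>Exchanging both coordinates exchanges \<open>a2\<close> and \<open>b1\<close>, so that the case \<open>b1 \<noteq> 0\<close> reduces to the case
  \<open>a2 \<noteq> 0\<close>.\<close>

lemma planar_nilpotent_swap:
  assumes "planar_nilpotent a b a1 a2 b1 b2"
  shows "planar_nilpotent (b \<circ> prod.swap) (a \<circ> prod.swap) (b2 \<circ> prod.swap) (b1 \<circ> prod.swap)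
           (a2 \<circ> prod.swap) (a1 \<circ> prod.swap)"
proof -
  interpret planar_nilpotent a b a1 a2 b1 b2 by fact
  have sw: "(prod.swap has_derivative prod.swap) (at z)" for z :: "real \<times> real"
    unfolding prod.swap_def by (intro derivative_intros)
  have contsw: "continuous_on UNIV (f \<circ> prod.swap)" if "continuous_on UNIV f"
    for f :: "real \<times> real \<Rightarrow> real"
    using that continuous_on_compose2[OF that continuous_on_swap, of UNIV] by (simp add: o_def)
  show ?thesis
  proof
    fix z
    show "(b \<circ> prod.swap has_derivative (\<lambda>w. (b2 \<circ> prod.swap) z * fst w + (b1 \<circ> prod.swap) z * snd w)) (at z)"
      unfolding o_def by (rule has_derivative_eq_rhs[OF has_derivative_compose[OF sw deriv_b]]) auto
    show "(a \<circ> prod.swap has_derivative (\<lambda>w. (a2 \<circ> prod.swap) z * fst w + (a1 \<circ> prod.swap) z * snd w)) (at z)"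
      unfolding o_def by (rule has_derivative_eq_rhs[OF has_derivative_compose[OF sw deriv_a]]) auto
    show "(b2 \<circ> prod.swap) z + (a1 \<circ> prod.swap) z = 0"
      using trace[of "prod.swap z"] by simp
    show "(b2 \<circ> prod.swap) z * (a1 \<circ> prod.swap) z - (b1 \<circ> prod.swap) z * (a2 \<circ> prod.swap) z = 0"
      using det[of "prod.swap z"] by (simp add: mult.commute)
  qed (intro contsw cont_a1 cont_a2 cont_b1 cont_b2)+
qed

context planar_nilpotent
begin

lemma ex_kernel_line:
  assumes "a2 p \<noteq> 0 \<or> b1 p \<noteq> 0"
  obtains v where "kernel_line p v"
proof (cases "a2 p = 0")
  case False
  then show thesis using kernel_line_if_a2 that by blast
next
  case True
  interpret sw: planar_nilpotent "b \<circ> prod.swap" "a \<circ> prod.swap" "b2 \<circ> prod.swap" "b1 \<circ> prod.swap"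
      "a2 \<circ> prod.swap" "a1 \<circ> prod.swap"
    by (rule planar_nilpotent_swap) unfold_locales
  obtain v where v: "sw.kernel_line (prod.swap p) v"
    using sw.kernel_line_if_a2[of "prod.swap p"] True assms by auto
  have sw: "prod.swap (prod.swap p + t *\<^sub>R v) = p + t *\<^sub>R prod.swap v" for t
    by (simp add: prod_eq_iff)
  have "kernel_line p (prod.swap v)"
    using v[unfolded sw.kernel_line_def, unfolded Let_def o_def sw] unfolding kernel_line_def Let_def
    by (auto simp: prod_eq_iff algebra_simps)
  then show thesis by (rule that)
qed

text \<open>Lines in two independent directions meet, and at the common point the derivative would annihilate
  two independent vectors without being zero. So all kernel lines are parallel.\<close>

lemma common_kernel:
  obtains v where "v \<noteq> 0" and "\<And>z. a1 z * fst v + a2 z * snd v = 0"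
    and "\<And>z. b1 z * fst v + b2 z * snd v = 0"
proof (cases "\<exists>p. a2 p \<noteq> 0 \<or> b1 p \<noteq> 0")
  case False
  then have "a2 z = 0" "b1 z = 0" for z by blast+
  moreover from this have "a1 z = 0" "b2 z = 0" for z using det[of z] trace[of z] by auto
  ultimately show thesis by (intro that[of "(1,0)"]) (auto simp: zero_prod_def)
next
  case True
  then obtain p v where pv: "kernel_line p v" using ex_kernel_line by metis
  have "a1 z * fst v + a2 z * snd v = 0 \<and> b1 z * fst v + b2 z * snd v = 0" for z
  proof (cases "a2 z \<noteq> 0 \<or> b1 z \<noteq> 0")
    case False
    then show ?thesis using det[of z] trace[of z] by auto
  next
    case True
    then obtain w where zw: "kernel_line z w" using ex_kernel_line by metis
    define D where "D = fst v * snd w - snd v * fst w"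
    have "D = 0"
    proof (rule ccontr)
      assume "D \<noteq> 0"
      \<comment> \<open>By Cramer's rule the two lines meet in a point \<open>q\<close>, where the derivative would have two independent null vectors.\<close>
      define t where "t = (fst (z - p) * snd w - snd (z - p) * fst w) / D"
      define s where "s = (fst (z - p) * snd v - snd (z - p) * fst v) / D"
      define q where "q = p + t *\<^sub>R v"
      have "fst (t *\<^sub>R v) - fst (s *\<^sub>R w) = fst (z - p) * D / D"
        unfolding t_def s_def D_def by (simp add: field_simps diff_divide_distrib[symmetric] add_divide_distrib[symmetric])
      moreover have "snd (t *\<^sub>R v) - snd (s *\<^sub>R w) = snd (z - p) * D / D"
        unfolding t_def s_def D_def by (simp add: field_simps diff_divide_distrib[symmetric] add_divide_distrib[symmetric])
      ultimately have q: "q = z + s *\<^sub>R w" using \<open>D \<noteq> 0\<close> by (simp add: q_def prod_eq_iff)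
      have v: "a1 q * fst v + a2 q * snd v = 0" "b1 q * fst v + b2 q * snd v = 0"
        and nz: "a2 q \<noteq> 0 \<or> b1 q \<noteq> 0"
        using pv unfolding kernel_line_def Let_def q_def by blast+
      have w: "a1 q * fst w + a2 q * snd w = 0" "b1 q * fst w + b2 q * snd w = 0"
        using zw unfolding kernel_line_def Let_def q by blast+
      have "a2 q * D = fst v * (a1 q * fst w + a2 q * snd w) - fst w * (a1 q * fst v + a2 q * snd v)"
        by (simp add: D_def algebra_simps)
      then have "a2 q = 0" using v w \<open>D \<noteq> 0\<close> by simp
      have "b1 q * D = snd w * (b1 q * fst v + b2 q * snd v) - snd v * (b1 q * fst w + b2 q * snd w)"
        by (simp add: D_def algebra_simps)
      then have "b1 q = 0" using v w \<open>D \<noteq> 0\<close> by simp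
      with \<open>a2 q = 0\<close> nz show False by simp
    qed
    have w0: "w \<noteq> 0" and w: "a1 z * fst w + a2 z * snd w = 0" "b1 z * fst w + b2 z * snd w = 0"
      using zw spec[of "\<lambda>t. let q = z + t *\<^sub>R w in (a2 q \<noteq> 0 \<or> b1 q \<noteq> 0) \<and>
        a1 q * fst w + a2 q * snd w = 0 \<and> b1 q * fst w + b2 q * snd w = 0" 0]
      unfolding kernel_line_def by (auto simp: Let_def)
    have par: "c * fst v + d * snd v = 0" if "c * fst w + d * snd w = 0" for c d
    proof -
      have "fst w * (c * fst v + d * snd v) = fst v * (c * fst w + d * snd w) - d * D"
        "snd w * (c * fst v + d * snd v) = snd v * (c * fst w + d * snd w) + c * D"
        by (simp_all add: D_def algebra_simps)
      then show ?thesis using w0 that \<open>D = 0\<close> by (auto simp: prod_eq_iff)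
    qed
    show ?thesis using par w by blast
  qed
  then show thesis using pv that unfolding kernel_line_def by blast
qed

end

section \<open>Dynamics of shears\<close>

locale planar_frame =
  fixes u v :: "real^2"
  assumes uu: "u \<bullet> u = 1" and vv: "v \<bullet> v = 1" and uv: "u \<bullet> v = 0"
    and expand: "\<And>z. z = (u \<bullet> z) *\<^sub>R u + (v \<bullet> z) *\<^sub>R v"
begin

lemma norm_le_coordinates: "norm z \<le> \<bar>u \<bullet> z\<bar> + \<bar>v \<bullet> z\<bar>"
proof -
  have "norm u = 1" "norm v = 1" using uu vv by (simp_all add: norm_eq_1)
  then have "norm ((u \<bullet> z) *\<^sub>R u + (v \<bullet> z) *\<^sub>R v) \<le> \<bar>u \<bullet> z\<bar> + \<bar>v \<bullet> z\<bar>"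
    using norm_triangle_ineq[of "(u \<bullet> z) *\<^sub>R u" "(v \<bullet> z) *\<^sub>R v"] by simp
  then show ?thesis using expand[of z] by simp
qed

definition shear :: "real \<Rightarrow> (real \<Rightarrow> real) \<Rightarrow> real^2 \<Rightarrow> real^2" where
  "shear \<kappa> \<phi> z = \<kappa> *\<^sub>R z + \<phi> (u \<bullet> z) *\<^sub>R v"

lemma inner_shear [simp]:
  "u \<bullet> shear \<kappa> \<phi> z = \<kappa> * (u \<bullet> z)" "v \<bullet> shear \<kappa> \<phi> z = \<kappa> * (v \<bullet> z) + \<phi> (u \<bullet> z)"
  by (simp_all add: shear_def inner_add_right uv vv)

lemma homeomorphism_shear:
  assumes "\<kappa> \<noteq> 0" and "continuous_on UNIV \<phi>"
  shows "homeomorphism UNIV UNIV (shear \<kappa> \<phi>) (shear (1 / \<kappa>) (\<lambda>s. - \<phi> (s / \<kappa>) / \<kappa>))"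
    (is "homeomorphism _ _ ?F ?G")
proof -
  have GF: "?G (?F z) = z" for z
    using assms(1) unfolding shear_def[of "1 / \<kappa>"] inner_shear
    by (simp add: shear_def algebra_simps)
  have FG: "?F (?G z) = z" for z
    using assms(1) unfolding shear_def[of \<kappa>] inner_shear
    by (simp add: shear_def algebra_simps)
  have cont: "continuous_on UNIV (shear k \<psi>)" if "continuous_on UNIV \<psi>" for k \<psi>
    unfolding shear_def
    by (intro continuous_intros continuous_on_compose2[OF that]) auto
  show ?thesis
    unfolding homeomorphism_def
  proof (intro conjI ballI)
    show "?F ` UNIV = UNIV" "?G ` UNIV = UNIV" using FG GF by (metis surjI)+
    show "continuous_on UNIV ?F" by (rule cont assms)+
    show "continuous_on UNIV ?G"
      by (intro cont continuous_intros continuous_on_compose2[OF assms(2)]) (use assms(1) in auto)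
  qed (use FG GF in auto)
qed

text \<open>A large weight \<open>M\<close> on the \<open>u\<close>-coordinate absorbs the growth that the shearing term causes in the
  \<open>v\<close>-coordinate.\<close>

definition adapted_norm :: "real \<Rightarrow> real^2 \<Rightarrow> real" where
  "adapted_norm M z = M * \<bar>u \<bullet> z\<bar> + \<bar>v \<bullet> z\<bar>"

lemma norm_le_adapted_norm:
  assumes "M \<ge> 1" shows "norm z \<le> adapted_norm M z"
  using norm_le_coordinates[of z] mult_right_mono[OF assms, of "\<bar>u \<bullet> z\<bar>"]
  by (simp add: adapted_norm_def)

text \<open>If \<open>\<bar>\<phi> s\<bar> \<le> C * \<bar>s\<bar>\<close> in the strip \<open>\<bar>u \<bullet> z\<bar> \<le> R\<close>, then the shear multiplies the adapted norm there by at
  most \<open>(1 + \<kappa>) / 2\<close> as soon as \<open>M * \<kappa> + C \<le> M * (1 + \<kappa>) / 2\<close>. The strip is invariant, so the estimate can be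
  iterated. The weight depends on the strip, because \<open>\<phi>\<close> may grow faster than linearly.\<close>

lemma shear_contracts:
  assumes \<kappa>: "0 < \<kappa>" "\<kappa> < 1" and lin: "\<And>R. \<exists>C. \<forall>s. \<bar>s\<bar> \<le> R \<longrightarrow> \<bar>\<phi> s\<bar> \<le> C * \<bar>s\<bar>"
  obtains M where "M \<ge> 1"
    and "\<And>z n. \<bar>u \<bullet> z\<bar> \<le> R \<Longrightarrow>
           adapted_norm M ((shear \<kappa> \<phi> ^^ n) z) \<le> ((1 + \<kappa>) / 2) ^ n * adapted_norm M z"
proof -
  obtain C where C: "\<And>s. \<bar>s\<bar> \<le> R \<Longrightarrow> \<bar>\<phi> s\<bar> \<le> C * \<bar>s\<bar>" using lin by blast
  define M where "M = max 1 (2 * C / (1 - \<kappa>))"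
  define \<rho> where "\<rho> = (1 + \<kappa>) / 2"
  have "2 * C / (1 - \<kappa>) \<le> M" by (simp add: M_def)
  then have "C \<le> M * ((1 - \<kappa>) / 2)" using \<kappa> by (simp add: field_simps)
  then have M: "M * \<kappa> + C \<le> \<rho> * M" by (simp add: \<rho>_def field_simps)
  have \<rho>: "\<kappa> \<le> \<rho>" "0 \<le> \<rho>" using \<kappa> by (auto simp: \<rho>_def)
  have step: "adapted_norm M (shear \<kappa> \<phi> z) \<le> \<rho> * adapted_norm M z" if "\<bar>u \<bullet> z\<bar> \<le> R" for z
  proof -
    have "adapted_norm M (shear \<kappa> \<phi> z) = M * \<kappa> * \<bar>u \<bullet> z\<bar> + \<bar>\<kappa> * (v \<bullet> z) + \<phi> (u \<bullet> z)\<bar>"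
      using \<kappa> by (simp add: adapted_norm_def abs_mult)
    also have "\<dots> \<le> M * \<kappa> * \<bar>u \<bullet> z\<bar> + (\<kappa> * \<bar>v \<bullet> z\<bar> + C * \<bar>u \<bullet> z\<bar>)"
      using abs_triangle_ineq[of "\<kappa> * (v \<bullet> z)" "\<phi> (u \<bullet> z)"] C[OF that] \<kappa>
      by (simp add: abs_mult)
    also have "\<dots> = (M * \<kappa> + C) * \<bar>u \<bullet> z\<bar> + \<kappa> * \<bar>v \<bullet> z\<bar>" by (simp add: algebra_simps)
    also have "\<dots> \<le> \<rho> * M * \<bar>u \<bullet> z\<bar> + \<rho> * \<bar>v \<bullet> z\<bar>"
      using M \<rho> by (intro add_mono mult_right_mono) auto
    finally show ?thesis by (simp add: adapted_norm_def algebra_simps)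
  qed
  have orbit: "adapted_norm M ((shear \<kappa> \<phi> ^^ n) z) \<le> \<rho> ^ n * adapted_norm M z \<and>
      \<bar>u \<bullet> (shear \<kappa> \<phi> ^^ n) z\<bar> \<le> R" if "\<bar>u \<bullet> z\<bar> \<le> R" for z n
  proof (induction n)
    case 0
    then show ?case using that by simp
  next
    case (Suc n)
    let ?w = "(shear \<kappa> \<phi> ^^ n) z"
    have "adapted_norm M (shear \<kappa> \<phi> ?w) \<le> \<rho> * adapted_norm M ?w" using step Suc by blast
    also have "\<dots> \<le> \<rho> * (\<rho> ^ n * adapted_norm M z)" using Suc \<rho> by (intro mult_left_mono) auto
    finally have 1: "adapted_norm M (shear \<kappa> \<phi> ?w) \<le> \<rho> ^ Suc n * adapted_norm M z" by simp
    have "\<bar>u \<bullet> shear \<kappa> \<phi> ?w\<bar> \<le> 1 * \<bar>u \<bullet> ?w\<bar>"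
      using \<kappa> by (simp add: abs_mult mult_left_le_one_le)
    with 1 Suc show ?case by simp
  qed
  show thesis
    by (rule that[of M]) (use orbit in \<open>auto simp: M_def \<rho>_def\<close>)
qed

text \<open>The unit ball of a norm is a compact convex set with interior points, hence a disc.\<close>

lemma topological_disc_adapted_norm:
  assumes "M \<ge> 1"
  shows "topological_disc {z. adapted_norm M z \<le> 1}" and "0 \<in> interior {z. adapted_norm M z \<le> 1}"
    and "{z. adapted_norm M z < 1} \<subseteq> interior {z. adapted_norm M z \<le> 1}"
proof -
  let ?D = "{z. adapted_norm M z \<le> 1}"
  have cont: "continuous_on UNIV (adapted_norm M)"
    unfolding adapted_norm_def by (intro continuous_intros)
  have "open {z. adapted_norm M z < 1}"
    by (intro open_Collect_less cont continuous_intros)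
  then show sub: "{z. adapted_norm M z < 1} \<subseteq> interior ?D"
    by (intro interior_maximal) auto
  then show 0: "0 \<in> interior ?D" by (auto simp: adapted_norm_def)
  have "closed ?D" by (intro closed_Collect_le cont continuous_intros)
  moreover have "bounded ?D"
    unfolding bounded_iff using norm_le_adapted_norm[OF assms] order_trans by (intro exI[of _ 1]) blast
  ultimately have "compact ?D" by (simp add: compact_eq_bounded_closed)
  moreover have "convex_on UNIV (adapted_norm M)"
  proof -
    have "convex_on UNIV (\<lambda>z. \<bar>w \<bullet> z\<bar>)" for w :: "real^2"
    proof (rule convex_onI)
      fix t :: real and x y :: "real^2" assume t: "0 < t" "t < 1"
      have "\<bar>w \<bullet> ((1 - t) *\<^sub>R x + t *\<^sub>R y)\<bar> \<le> \<bar>(1 - t) * (w \<bullet> x)\<bar> + \<bar>t * (w \<bullet> y)\<bar>"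
        by (simp add: inner_add_right abs_triangle_ineq)
      then show "\<bar>w \<bullet> ((1 - t) *\<^sub>R x + t *\<^sub>R y)\<bar> \<le> (1 - t) * \<bar>w \<bullet> x\<bar> + t * \<bar>w \<bullet> y\<bar>"
        using t by (simp add: abs_mult)
    qed simp
    then show ?thesis
      unfolding adapted_norm_def using assms by (intro convex_on_add convex_on_cmul) auto
  qed
  then have "convex ?D"
    unfolding convex_alt
    using order_trans[OF convex_onD[of UNIV "adapted_norm M"] convex_bound_le] by simp
  ultimately have "?D homeomorphic (cball 0 1 :: (real^2) set)"
    by (intro homeomorphic_convex_compact_cball) (use 0 in auto)
  moreover have "{z :: real^2. norm z \<le> 1} = cball 0 1" by (auto simp: dist_norm)
  ultimately show "topological_disc ?D" by (simp add: topological_disc_def)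
qed

text \<open>The disc is the unit ball of the norm adapted to the strip \<open>\<bar>u \<bullet> z\<bar> \<le> 1\<close>, which contains that ball
  because \<open>M \<ge> 1\<close>. For the orbit of an arbitrary point \<open>p\<close> the norm is adapted to the strip through \<open>p\<close>.\<close>

theorem global_attractor_shear:
  assumes \<kappa>: "0 < \<kappa>" "\<kappa> < 1" and cont: "continuous_on UNIV \<phi>"
    and lin: "\<And>R. \<exists>C. \<forall>s. \<bar>s\<bar> \<le> R \<longrightarrow> \<bar>\<phi> s\<bar> \<le> C * \<bar>s\<bar>"
  shows "global_attractor (shear \<kappa> \<phi>)"
proof -
  let ?F = "shear \<kappa> \<phi>"
  define \<rho> where "\<rho> = (1 + \<kappa>) / 2"
  have \<rho>: "0 \<le> \<rho>" "\<rho> < 1" using \<kappa> by (auto simp: \<rho>_def)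
  have "\<phi> 0 = 0" using lin[of 0] by force
  then have "?F 0 = 0" by (simp add: shear_def)
  then have F0: "(?F ^^ n) 0 = 0" for n by (induction n) auto
  have "topological_embedding ?F"
  proof -
    have hom: "homeomorphism UNIV UNIV ?F (shear (1 / \<kappa>) (\<lambda>s. - \<phi> (s / \<kappa>) / \<kappa>))"
      using \<kappa> by (intro homeomorphism_shear cont) auto
    then have "inj ?F" and "?F ` UNIV = UNIV" by (auto simp: homeomorphism_def intro: inj_on_inverseI)
    with hom show ?thesis
      unfolding topological_embedding_def local_homeomorphism_def
      by (intro conjI allI exI[of _ UNIV]) auto
  qed
  moreover have "\<exists>D. topological_disc D \<and> 0 \<in> interior D \<and> ?F ` D \<subseteq> interior D \<and>
      (\<Inter>n\<in>{1..}. (?F ^^ n) ` D) = {0}"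
  proof -
    obtain M where M: "M \<ge> 1" and contr: "\<And>z n. \<bar>u \<bullet> z\<bar> \<le> 1 \<Longrightarrow>
        adapted_norm M ((?F ^^ n) z) \<le> \<rho> ^ n * adapted_norm M z"
      using shear_contracts[OF \<kappa> lin, of 1] unfolding \<rho>_def by metis
    define D where "D = {z. adapted_norm M z \<le> 1}"
    have D: "adapted_norm M ((?F ^^ n) z) \<le> \<rho> ^ n" if "z \<in> D" for z n
    proof -
      have le: "adapted_norm M z \<le> 1" using that by (simp add: D_def)
      moreover have "\<bar>u \<bullet> z\<bar> \<le> M * \<bar>u \<bullet> z\<bar>" using mult_right_mono[OF M, of "\<bar>u \<bullet> z\<bar>"] by simp
      ultimately have "\<bar>u \<bullet> z\<bar> \<le> 1" by (simp add: adapted_norm_def)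
      from contr[OF this] show ?thesis
        using mult_left_mono[OF le, of "\<rho> ^ n"] \<rho> by (smt (verit) mult.right_neutral zero_le_power)
    qed
    have "?F ` D \<subseteq> interior D"
      using D[of _ 1] \<rho> topological_disc_adapted_norm(3)[OF M] unfolding D_def by fastforce
    moreover have "(\<Inter>n\<in>{1..}. (?F ^^ n) ` D) = {0}"
    proof
      have "0 \<in> D" by (simp add: D_def adapted_norm_def)
      then show "{0} \<subseteq> (\<Inter>n\<in>{1..}. (?F ^^ n) ` D)" using F0 by (auto simp: image_iff intro!: bexI[of _ 0])
      show "(\<Inter>n\<in>{1..}. (?F ^^ n) ` D) \<subseteq> {0}"
      proof
        fix z assume z: "z \<in> (\<Inter>n\<in>{1..}. (?F ^^ n) ` D)"
        have "adapted_norm M z \<le> \<rho> ^ n" if "n \<ge> 1" for n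
          using z that D[of _ n] by (metis INT_iff atLeast_iff imageE)
        then have "adapted_norm M z \<le> 0"
          by (intro LIMSEQ_le_const[OF LIMSEQ_power_zero[of \<rho>]]) (use \<rho> in auto)
        then have "norm z \<le> 0" using norm_le_adapted_norm[OF M, of z] by linarith
        then show "z \<in> {0}" by simp
      qed
    qed
    ultimately show ?thesis
      using topological_disc_adapted_norm[OF M] unfolding D_def by blast
  qed
  moreover have "omega_limit ?F p = {0}" for p
  proof -
    obtain M where M: "M \<ge> 1" and contr: "\<And>z n. \<bar>u \<bullet> z\<bar> \<le> \<bar>u \<bullet> p\<bar> \<Longrightarrow>
        adapted_norm M ((?F ^^ n) z) \<le> \<rho> ^ n * adapted_norm M z"
      using shear_contracts[OF \<kappa> lin, of "\<bar>u \<bullet> p\<bar>"] unfolding \<rho>_def by metis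
    have le: "norm ((?F ^^ n) p) \<le> \<rho> ^ n * adapted_norm M p" for n
      by (rule order_trans[OF norm_le_adapted_norm[OF M] contr]) simp
    have "(\<lambda>n. \<rho> ^ n * adapted_norm M p) \<longlonglongrightarrow> 0"
      using \<rho> by (intro tendsto_mult_left_zero LIMSEQ_power_zero) auto
    then have lim: "(\<lambda>n. (?F ^^ n) p) \<longlonglongrightarrow> 0"
      by (rule Lim_null_comparison[OF always_eventually[OF allI[OF le]]])
    have "z = 0" if "filterlim n at_top sequentially" "(\<lambda>k. (?F ^^ n k) p) \<longlonglongrightarrow> z" for n z
      using LIMSEQ_unique[OF that(2) filterlim_compose[OF lim that(1)]] .
    moreover have "0 \<in> omega_limit ?F p"
      unfolding omega_limit_def using lim filterlim_ident by (intro CollectI exI[of _ "\<lambda>n. n"] conjI)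
    ultimately show ?thesis by (auto simp: omega_limit_def)
  qed
  ultimately show ?thesis by (simp add: global_attractor_def local_attractor_def)
qed

text \<open>The inverse of a shear with factor \<open>\<kappa>\<close> is a shear with factor \<open>1 / \<kappa>\<close>.\<close>

theorem global_repellor_shear:
  assumes \<kappa>: "\<kappa> > 1" and cont: "continuous_on UNIV \<phi>"
    and lin: "\<And>R. \<exists>C. \<forall>s. \<bar>s\<bar> \<le> R \<longrightarrow> \<bar>\<phi> s\<bar> \<le> C * \<bar>s\<bar>"
  shows "global_repellor (shear \<kappa> \<phi>)"
proof -
  define \<psi> where "\<psi> s = - \<phi> (s / \<kappa>) / \<kappa>" for s
  have hom: "homeomorphism UNIV UNIV (shear \<kappa> \<phi>) (shear (1 / \<kappa>) \<psi>)"
    unfolding \<psi>_def using \<kappa> by (intro homeomorphism_shear cont) auto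
  then have inv: "inv (shear \<kappa> \<phi>) = shear (1 / \<kappa>) \<psi>"
    by (intro inv_equality) (auto simp: homeomorphism_def)
  have "\<phi> 0 = 0" using lin[of 0] by force
  moreover have "global_attractor (shear (1 / \<kappa>) \<psi>)"
  proof (rule global_attractor_shear)
    show "continuous_on UNIV \<psi>"
      unfolding \<psi>_def
      by (intro continuous_intros continuous_on_compose2[OF cont]) (use \<kappa> in auto)
    show "\<exists>C. \<forall>s. \<bar>s\<bar> \<le> R \<longrightarrow> \<bar>\<psi> s\<bar> \<le> C * \<bar>s\<bar>" for R
    proof -
      obtain C where C: "\<And>s. \<bar>s\<bar> \<le> R / \<kappa> \<Longrightarrow> \<bar>\<phi> s\<bar> \<le> C * \<bar>s\<bar>" using lin by blast
      have "\<bar>\<psi> s\<bar> \<le> (C / \<kappa> / \<kappa>) * \<bar>s\<bar>" if "\<bar>s\<bar> \<le> R" for s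
        using C[of "s / \<kappa>"] that \<kappa> by (simp add: \<psi>_def divide_right_mono field_simps)
      then show ?thesis by blast
    qed
  qed (use \<kappa> in auto)
  ultimately show ?thesis
    using hom by (simp add: global_repellor_def inv shear_def[of \<kappa> \<phi> 0])
qed

lemma inner_shear_power: "u \<bullet> (shear \<kappa> \<phi> ^^ n) z = \<kappa> ^ n * (u \<bullet> z)"
  by (induction n) auto

text \<open>If \<open>\<kappa> \<noteq> 1\<close>, the \<open>u\<close>-coordinate of a point that returns must vanish, and on that axis the shear is
  multiplication by \<open>\<kappa>\<close>, so the point is the origin. If \<open>\<kappa> = 1\<close>, the orbit moves along \<open>v\<close> in equal
  steps, so a point that returns does not move at all. Fixed points are not periodic by definition.\<close>

theorem no_periodic_point_shear:
  assumes \<kappa>: "\<kappa> > 0" and "\<phi> 0 = 0"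
  shows "\<not> periodic_point (shear \<kappa> \<phi>) z"
proof
  let ?F = "shear \<kappa> \<phi>"
  assume "periodic_point ?F z"
  then obtain p where p: "p > 1" "(?F ^^ p) z = z" and minimal: "\<And>m. 1 \<le> m \<Longrightarrow> m \<le> p - 1 \<Longrightarrow> (?F ^^ m) z \<noteq> z"
    by (auto simp: periodic_point_def)
  have not_fixed: "?F z \<noteq> z" using minimal[of 1] p by simp
  show False
  proof (cases "\<kappa> = 1")
    case True
    have "(?F ^^ n) z = z + (real n * \<phi> (u \<bullet> z)) *\<^sub>R v" for n
    proof (induction n)
      case (Suc n)
      have "u \<bullet> (?F ^^ n) z = u \<bullet> z" by (simp add: inner_shear_power True)
      then have "?F ((?F ^^ n) z) = (?F ^^ n) z + \<phi> (u \<bullet> z) *\<^sub>R v"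
        by (simp add: shear_def True)
      with Suc show ?case by (simp add: algebra_simps)
    qed simp
    from this[of p] p have "\<phi> (u \<bullet> z) = 0 \<or> v = 0" by simp
    with not_fixed True show False by (auto simp: shear_def)
  next
    case False
    have "\<kappa> ^ p \<noteq> 1" using False \<kappa> p power_eq_iff_eq_base[of p \<kappa> 1] by simp
    have "\<kappa> ^ p * (u \<bullet> z) = u \<bullet> z" using inner_shear_power[of p \<kappa> \<phi> z] p by simp
    then have uz: "u \<bullet> z = 0" using \<open>\<kappa> ^ p \<noteq> 1\<close> by simp
    have "(?F ^^ n) z = \<kappa> ^ n *\<^sub>R z" for n
      by (induction n) (simp_all add: shear_def uz assms(2))
    from this[of p] p have "\<kappa> ^ p *\<^sub>R z = 1 *\<^sub>R z" by simp
    then have "z = 0" using \<open>\<kappa> ^ p \<noteq> 1\<close> by (metis scaleR_cancel_right)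
    then show False using not_fixed by (simp add: shear_def assms(2))
  qed
qed

end

section \<open>Unipotent maps\<close>

text \<open>An eigenvector can be read off the first or second row of \<open>A - r\<close>; if neither gives a nonzero
  vector, \<open>A - r\<close> is zero and every vector will do.\<close>

lemma complex_eigenvalue_if_char_root:
  fixes A :: "real^2^2" and r :: complex
  assumes "r\<^sup>2 - of_real (A $ 1 $ 1 + A $ 2 $ 2) * r
             + of_real (A $ 1 $ 1 * A $ 2 $ 2 - A $ 1 $ 2 * A $ 2 $ 1) = 0"
  shows "complex_eigenvalue A r"
proof -
  define a b c d where "a = complex_of_real (A $ 1 $ 1)" and "b = complex_of_real (A $ 1 $ 2)"
    and "c = complex_of_real (A $ 2 $ 1)" and "d = complex_of_real (A $ 2 $ 2)"
  have root: "(r - a) * (r - d) = b * c"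
    using assms by (simp add: a_def b_def c_def d_def power2_eq_square algebra_simps)
  have eigen: "complex_eigenvalue A r"
    if "x \<noteq> 0 \<or> y \<noteq> 0" "a * x + b * y = r * x" "c * x + d * y = r * y" for x y
    unfolding complex_eigenvalue_def
    using that
    by (intro exI[of _ "vector [x, y] :: complex^2"])
       (auto simp: vec_eq_iff forall_2 matrix_vector_mult_def sum_2 map_matrix_def
          a_def b_def c_def d_def)
  consider "b \<noteq> 0 \<or> r \<noteq> a" | "c \<noteq> 0 \<or> r \<noteq> d" | "b = 0" "r = a" "c = 0" "r = d" by blast
  then show ?thesis
  proof cases
    case 1
    with root show ?thesis by (intro eigen[of b "r - a"]) (auto simp: algebra_simps)
  next
    case 2
    with root show ?thesis by (intro eigen[of "r - d" c]) (auto simp: algebra_simps)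
  next
    case 3
    then show ?thesis by (intro eigen[of 1 0]) auto
  qed
qed

text \<open>Both roots of the characteristic polynomial are eigenvalues, so both are 1; trace and determinant
  are their sum and product.\<close>

lemma trace_det_if_eigenvalues_1:
  fixes A :: "real^2^2"
  assumes "\<And>c. complex_eigenvalue A c \<Longrightarrow> c = 1"
  shows "A $ 1 $ 1 + A $ 2 $ 2 = 2" and "A $ 1 $ 1 * A $ 2 $ 2 - A $ 1 $ 2 * A $ 2 $ 1 = 1"
proof -
  define t where "t = complex_of_real (A $ 1 $ 1 + A $ 2 $ 2)"
  define d where "d = complex_of_real (A $ 1 $ 1 * A $ 2 $ 2 - A $ 1 $ 2 * A $ 2 $ 1)"
  define q where "q = csqrt (t\<^sup>2 - 4 * d)"
  have q: "q\<^sup>2 = t\<^sup>2 - 4 * d" by (simp add: q_def)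
  have "r = 1" if "r\<^sup>2 - t * r + d = 0" for r
    using assms complex_eigenvalue_if_char_root[of r A] that unfolding t_def d_def by blast
  moreover have square: "((t + q) / 2)\<^sup>2 - t * ((t + q) / 2) + d = (q\<^sup>2 - (t\<^sup>2 - 4 * d)) / 4"
      "((t - q) / 2)\<^sup>2 - t * ((t - q) / 2) + d = (q\<^sup>2 - (t\<^sup>2 - 4 * d)) / 4"
    by (simp_all add: power2_eq_square field_simps)
  moreover have "((t + q) / 2)\<^sup>2 - t * ((t + q) / 2) + d = 0" "((t - q) / 2)\<^sup>2 - t * ((t - q) / 2) + d = 0"
    unfolding square q by simp_all
  ultimately have "(t + q) / 2 = 1" "(t - q) / 2 = 1" by blast+
  then have "t + q = 2" "t - q = 2" by simp_all
  then have "(t + q) + (t - q) = 4" "q = 2 - t" by (simp_all add: algebra_simps)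
  then have t: "t = 2" and "q = 0" by simp_all
  with q have d: "d = 1" by simp
  show "A $ 1 $ 1 + A $ 2 $ 2 = 2"
    using t unfolding t_def by (metis of_real_eq_iff of_real_numeral)
  show "A $ 1 $ 1 * A $ 2 $ 2 - A $ 1 $ 2 * A $ 2 $ 1 = 1"
    using d unfolding d_def by (metis of_real_eq_1_iff)
qed

lemma unipotent_trace_det:
  fixes G :: "real^2 \<Rightarrow> real^2"
  assumes "unipotent G" and "(G has_derivative D) (at z)"
  shows "D (axis 1 1) $ 1 + D (axis 2 1) $ 2 = 2"
    and "D (axis 1 1) $ 1 * D (axis 2 1) $ 2 - D (axis 2 1) $ 1 * D (axis 1 1) $ 2 = 1"
proof -
  have "frechet_derivative G (at z) = D" by (rule frechet_derivative_at[OF assms(2), symmetric])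
  then have J: "jacobian G (at z) $ i $ j = D (axis j 1) $ i" for i j
    by (simp add: jacobian_def matrix_def)
  have "c = 1" if "complex_eigenvalue (jacobian G (at z)) c" for c
    using assms(1) that unfolding unipotent_def Spc_def by blast
  from trace_det_if_eigenvalues_1[of "jacobian G (at z)", OF this]
  show "D (axis 1 1) $ 1 + D (axis 2 1) $ 2 = 2"
    and "D (axis 1 1) $ 1 * D (axis 2 1) $ 2 - D (axis 2 1) $ 1 * D (axis 1 1) $ 2 = 1"
    by (simp_all add: J)
qed

lemma planar_frame_rotated:
  fixes v :: "real^2"
  assumes "norm v = 1"
  shows "planar_frame (vector [- (v $ 2), v $ 1]) v"
proof -
  have "v \<bullet> v = 1" using assms by (simp add: norm_eq_1)
  then have v: "v $ 1 * v $ 1 + v $ 2 * v $ 2 = 1" by (simp add: inner_vec_def sum_2)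
  have "(- (v $ 2) * z $ 1 + v $ 1 * z $ 2) * - (v $ 2) + (v $ 1 * z $ 1 + v $ 2 * z $ 2) * v $ 1
        = (v $ 1 * v $ 1 + v $ 2 * v $ 2) * z $ 1"
    "(- (v $ 2) * z $ 1 + v $ 1 * z $ 2) * v $ 1 + (v $ 1 * z $ 1 + v $ 2 * z $ 2) * v $ 2
        = (v $ 1 * v $ 1 + v $ 2 * v $ 2) * z $ 2" for z :: "real^2"
    by (simp_all add: algebra_simps)
  moreover have "v $ 2 * v $ 2 + v $ 1 * v $ 1 = 1" using v by simp
  ultimately show ?thesis
    by unfold_locales (simp_all add: v inner_vec_def sum_2 vec_eq_iff forall_2)
qed

lemma unipotent_common_kernel:
  fixes G :: "real^2 \<Rightarrow> real^2"
  assumes deriv: "\<And>z. (G has_derivative blinfun_apply (G' z)) (at z)" and cont: "continuous_on UNIV G'"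
    and "unipotent G"
  obtains v where "norm v = 1" and "\<And>z. blinfun_apply (G' z) v = v"
proof -
  define e1 e2 :: "real^2" where "e1 = axis 1 1" and "e2 = axis 2 1"
  \<comment> \<open>Coordinates as pairs of reals, for which the results on nilpotent derivatives are formulated.\<close>
  define \<iota> where "\<iota> w = fst w *\<^sub>R e1 + snd w *\<^sub>R e2" for w :: "real \<times> real"
  have \<iota>_nth: "\<iota> w $ 1 = fst w" "\<iota> w $ 2 = snd w" for w
    by (simp_all add: \<iota>_def e1_def e2_def axis_def)
  have \<iota>_surj: "\<iota> (z $ 1, z $ 2) = z" for z by (simp add: vec_eq_iff forall_2 \<iota>_nth)
  have D_\<iota>: "blinfun_apply (G' z) (\<iota> w) = fst w *\<^sub>R blinfun_apply (G' z) e1 + snd w *\<^sub>R blinfun_apply (G' z) e2"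
    for z w by (simp add: \<iota>_def blinfun.add_right blinfun.scaleR_right)
  have d\<iota>: "(\<iota> has_derivative \<iota>) (at w)" for w
    unfolding \<iota>_def by (intro derivative_intros)
  have cont\<iota>: "continuous_on UNIV \<iota>" unfolding \<iota>_def by (intro continuous_intros)
  have contD: "continuous_on UNIV (\<lambda>w. blinfun_apply (G' (\<iota> w)) e $ i)" for e i
    by (intro continuous_intros continuous_on_compose2[OF cont cont\<iota>]) auto
  have dG: "((\<lambda>w. G (\<iota> w) $ i) has_derivative (\<lambda>w. blinfun_apply (G' (\<iota> z)) (\<iota> w) $ i)) (at z)" for z i
    using bounded_linear.has_derivative[OF bounded_linear_vec_nth has_derivative_compose[OF d\<iota> deriv]] .
  interpret planar_nilpotent "\<lambda>w. G (\<iota> w) $ 1 - fst w" "\<lambda>w. G (\<iota> w) $ 2 - snd w"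
    "\<lambda>w. blinfun_apply (G' (\<iota> w)) e1 $ 1 - 1" "\<lambda>w. blinfun_apply (G' (\<iota> w)) e2 $ 1"
    "\<lambda>w. blinfun_apply (G' (\<iota> w)) e1 $ 2" "\<lambda>w. blinfun_apply (G' (\<iota> w)) e2 $ 2 - 1"
  proof
    fix z
    show "((\<lambda>w. G (\<iota> w) $ 1 - fst w) has_derivative
        (\<lambda>w. (blinfun_apply (G' (\<iota> z)) e1 $ 1 - 1) * fst w + blinfun_apply (G' (\<iota> z)) e2 $ 1 * snd w)) (at z)"
      by (rule has_derivative_eq_rhs[OF has_derivative_diff[OF dG has_derivative_fst[OF has_derivative_ident]]])
         (simp add: D_\<iota> fun_eq_iff algebra_simps)
    show "((\<lambda>w. G (\<iota> w) $ 2 - snd w) has_derivative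
        (\<lambda>w. blinfun_apply (G' (\<iota> z)) e1 $ 2 * fst w + (blinfun_apply (G' (\<iota> z)) e2 $ 2 - 1) * snd w)) (at z)"
      by (rule has_derivative_eq_rhs[OF has_derivative_diff[OF dG has_derivative_snd[OF has_derivative_ident]]])
         (simp add: D_\<iota> fun_eq_iff algebra_simps)
    note td = unipotent_trace_det[OF \<open>unipotent G\<close> deriv[of "\<iota> z"], folded e1_def e2_def]
    show "blinfun_apply (G' (\<iota> z)) e1 $ 1 - 1 + (blinfun_apply (G' (\<iota> z)) e2 $ 2 - 1) = 0"
      using td(1) by simp
    show "(blinfun_apply (G' (\<iota> z)) e1 $ 1 - 1) * (blinfun_apply (G' (\<iota> z)) e2 $ 2 - 1)
        - blinfun_apply (G' (\<iota> z)) e2 $ 1 * blinfun_apply (G' (\<iota> z)) e1 $ 2 = 0"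
      using td by (simp add: algebra_simps)
  qed (intro contD continuous_on_diff continuous_on_const)+
  obtain w where w: "w \<noteq> 0"
    and ker: "\<And>z. (blinfun_apply (G' (\<iota> z)) e1 $ 1 - 1) * fst w + blinfun_apply (G' (\<iota> z)) e2 $ 1 * snd w = 0"
      "\<And>z. blinfun_apply (G' (\<iota> z)) e1 $ 2 * fst w + (blinfun_apply (G' (\<iota> z)) e2 $ 2 - 1) * snd w = 0"
    using common_kernel by metis
  have fix_w: "blinfun_apply (G' z) (\<iota> w) = \<iota> w" for z
    using ker[of "(z $ 1, z $ 2)"] unfolding \<iota>_surj
    by (simp add: vec_eq_iff forall_2 D_\<iota> \<iota>_nth algebra_simps)
  have "\<iota> w \<noteq> 0" using w \<iota>_nth[of w] by (auto simp: prod_eq_iff)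
  then show thesis
    by (intro that[of "sgn (\<iota> w)"]) (simp_all add: norm_sgn sgn_div_norm blinfun.scaleR_right fix_w)
qed

text \<open>Put \<open>H z = G z - z\<close>. A common null vector \<open>v\<close> of its derivatives makes \<open>H\<close> invariant under
  translation along \<open>v\<close>, so \<open>H z\<close> depends on \<open>u \<bullet> z\<close> only, where \<open>u\<close> is orthogonal to \<open>v\<close>. Since the
  trace vanishes too, the derivative maps into the line spanned by \<open>v\<close>; as \<open>H 0 = 0\<close>, so does \<open>H\<close>.
  The local linear bound on \<open>\<phi>\<close> comes from its being \<open>C\<^sup>1\<close> with \<open>\<phi> 0 = 0\<close>.\<close>

theorem unipotent_normal_form:
  fixes G :: "real^2 \<Rightarrow> real^2"
  assumes "C1_map G" and "G 0 = 0" and "unipotent G"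
  obtains u v \<phi> where "planar_frame u v" and "continuous_on UNIV \<phi>" and "\<phi> 0 = 0"
    and "\<And>R. \<exists>C. \<forall>s. \<bar>s\<bar> \<le> R \<longrightarrow> \<bar>\<phi> s\<bar> \<le> C * \<bar>s\<bar>"
    and "\<And>z. G z = z + \<phi> (u \<bullet> z) *\<^sub>R v"
proof -
  obtain G' where deriv: "\<And>z. (G has_derivative blinfun_apply (G' z)) (at z)" and cont: "continuous_on UNIV G'"
    using assms(1) unfolding C1_map_def by blast
  obtain v where v: "norm v = 1" and fix_v: "\<And>z. blinfun_apply (G' z) v = v"
    using unipotent_common_kernel[OF deriv cont assms(3)] by metis
  define u where "u = (vector [- (v $ 2), v $ 1] :: real^2)"
  interpret planar_frame u v unfolding u_def by (rule planar_frame_rotated[OF v])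
  define H where "H z = G z - z" for z
  have dH: "(H has_derivative (\<lambda>h. blinfun_apply (G' z) h - h)) (at z)" for z
    unfolding H_def by (intro derivative_intros deriv)
  have image: "u \<bullet> (blinfun_apply (G' z) h - h) = 0" for z h
  proof -
    define p q where "p = blinfun_apply (G' z) (axis 1 1)" and "q = blinfun_apply (G' z) (axis 2 1)"
    have h: "h = h $ 1 *\<^sub>R axis 1 1 + h $ 2 *\<^sub>R axis 2 1" for h :: "real^2"
      by (simp add: vec_eq_iff forall_2 axis_def)
    have D: "blinfun_apply (G' z) h = h $ 1 *\<^sub>R p + h $ 2 *\<^sub>R q" for h
      by (subst h) (simp add: blinfun.add_right blinfun.scaleR_right p_def q_def)
    have "v $ 1 *\<^sub>R p + v $ 2 *\<^sub>R q = v" using fix_v[of z] by (simp add: D)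
    then have ker: "v $ 1 * p $ 1 + v $ 2 * q $ 1 = v $ 1" "v $ 1 * p $ 2 + v $ 2 * q $ 2 = v $ 2"
      by (simp_all add: vec_eq_iff forall_2)
    have p1: "p $ 1 = 2 - q $ 2"
      using unipotent_trace_det(1)[OF assms(3) deriv[of z]] by (simp add: p_def q_def)
    have "- (v $ 2) * (p $ 1 - 1) + v $ 1 * p $ 2 = 0" "- (v $ 2) * q $ 1 + v $ 1 * (q $ 2 - 1) = 0"
      using ker unfolding p1 by (simp_all add: algebra_simps)
    moreover have "u \<bullet> (blinfun_apply (G' z) h - h) =
        h $ 1 * (- (v $ 2) * (p $ 1 - 1) + v $ 1 * p $ 2) + h $ 2 * (- (v $ 2) * q $ 1 + v $ 1 * (q $ 2 - 1))"
      by (simp add: D u_def inner_vec_def sum_2 algebra_simps)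
    ultimately show ?thesis by simp
  qed
  have H0: "H 0 = 0" using assms(2) by (simp add: H_def)
  have uH: "u \<bullet> H z = 0" for z
  proof -
    have "\<exists>c. \<forall>z\<in>UNIV. u \<bullet> H z = c"
    proof (rule has_derivative_zero_constant)
      show "((\<lambda>z. u \<bullet> H z) has_derivative (\<lambda>h. 0)) (at z)" for z
        using has_derivative_inner_right[OF dH[of z], of u] by (simp add: image)
    qed simp
    then show ?thesis using H0 by (metis UNIV_I inner_zero_right)
  qed
  have invariant: "H (z + t *\<^sub>R v) = H z" for z t
  proof -
    have "\<exists>c. \<forall>t\<in>UNIV. H (z + t *\<^sub>R v) = c"
    proof (rule has_derivative_zero_constant)
      fix t :: real
      have "((\<lambda>t. z + t *\<^sub>R v) has_derivative (\<lambda>h. h *\<^sub>R v)) (at t)"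
        by (auto intro!: derivative_eq_intros)
      from has_derivative_compose[OF this dH]
      show "((\<lambda>t. H (z + t *\<^sub>R v)) has_derivative (\<lambda>h. 0)) (at t)"
        by (simp add: blinfun.scaleR_right fix_v)
    qed simp
    then have "H (z + t *\<^sub>R v) = H (z + 0 *\<^sub>R v)" by (metis UNIV_I)
    then show ?thesis by simp
  qed
  define \<phi> where "\<phi> s = v \<bullet> H (s *\<^sub>R u)" for s
  define \<phi>' where "\<phi>' s = v \<bullet> (blinfun_apply (G' (s *\<^sub>R u)) u - u)" for s
  have \<phi>0: "\<phi> 0 = 0" by (simp add: \<phi>_def H0)
  have d\<phi>: "(\<phi> has_real_derivative \<phi>' s) (at s)" for s
  proof -
    have "((\<lambda>s. s *\<^sub>R u) has_derivative (\<lambda>h. h *\<^sub>R u)) (at s)"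
      by (auto intro!: derivative_eq_intros)
    from has_derivative_inner_right[OF has_derivative_compose[OF this dH], of v]
    show ?thesis
      unfolding has_field_derivative_def \<phi>_def[abs_def]
      by (rule has_derivative_eq_rhs)
         (simp add: \<phi>'_def blinfun.scaleR_right scaleR_diff_right[symmetric] fun_eq_iff)
  qed
  have cont\<phi>: "continuous_on UNIV \<phi>"
    using d\<phi> by (meson DERIV_continuous continuous_at_imp_continuous_on)
  have cont\<phi>': "continuous_on UNIV \<phi>'"
    unfolding \<phi>'_def
    by (intro continuous_intros continuous_on_compose2[OF cont]) auto
  have lin: "\<exists>C. \<forall>s. \<bar>s\<bar> \<le> R \<longrightarrow> \<bar>\<phi> s\<bar> \<le> C * \<bar>s\<bar>" for R
  proof -
    have "bounded (\<phi>' ` cball 0 R)"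
      by (intro compact_imp_bounded compact_continuous_image continuous_on_subset[OF cont\<phi>']) auto
    then obtain C where C: "\<And>s. s \<in> cball 0 R \<Longrightarrow> norm (\<phi>' s) \<le> C" unfolding bounded_iff by blast
    have "norm (\<phi> s - \<phi> 0) \<le> C * norm (s - 0)" if "\<bar>s\<bar> \<le> R" for s
      by (rule field_differentiable_bound[OF convex_cball[of 0 R] _ C])
         (use that in \<open>auto intro: has_field_derivative_at_within d\<phi>\<close>)
    then show ?thesis using \<phi>0 by auto
  qed
  have "G z = z + \<phi> (u \<bullet> z) *\<^sub>R v" for z
  proof -
    have "H z = H ((u \<bullet> z) *\<^sub>R u)"
      using invariant[of "(u \<bullet> z) *\<^sub>R u" "v \<bullet> z"] expand[of z] by simp
    then have "v \<bullet> H z = \<phi> (u \<bullet> z)" by (simp add: \<phi>_def)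
    then have "H z = \<phi> (u \<bullet> z) *\<^sub>R v" using expand[of "H z"] uH[of z] by simp
    then show ?thesis by (simp add: H_def algebra_simps)
  qed
  then show thesis
    by (intro that[of u v \<phi>]) (use planar_frame_axioms cont\<phi> \<phi>0 lin in auto)
qed

section \<open>The family near a unipotent map\<close>

theorem theorem7p4:
  fixes G :: "real^2 \<Rightarrow> real^2"
  assumes "C1_map G" and "G 0 = 0" and "\<not> linear G" and "unipotent G"
  shows "\<exists>\<epsilon>>0.
      (\<forall>\<mu>. 0 < \<mu> \<and> \<mu> < \<epsilon> \<longrightarrow> global_attractor (\<lambda>z. G z - \<mu> *\<^sub>R z)) \<and>
      (\<forall>\<mu>. - \<epsilon> < \<mu> \<and> \<mu> < 0 \<longrightarrow> global_repellor (\<lambda>z. G z - \<mu> *\<^sub>R z)) \<and>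
      (\<forall>\<mu>. - \<epsilon> < \<mu> \<and> \<mu> < \<epsilon> \<longrightarrow>
           \<not> (\<exists>z. periodic_point (\<lambda>z. G z - \<mu> *\<^sub>R z) z))"
proof -
  obtain u v \<phi> where frame: "planar_frame u v" and cont: "continuous_on UNIV \<phi>" and \<phi>0: "\<phi> 0 = 0"
    and lin: "\<And>R. \<exists>C. \<forall>s. \<bar>s\<bar> \<le> R \<longrightarrow> \<bar>\<phi> s\<bar> \<le> C * \<bar>s\<bar>"
    and G: "\<And>z. G z = z + \<phi> (u \<bullet> z) *\<^sub>R v"
    by (rule unipotent_normal_form[OF assms(1,2,4)]) (rule that; assumption)
  interpret planar_frame u v by (rule frame)
  have shear: "(\<lambda>z. G z - \<mu> *\<^sub>R z) = shear (1 - \<mu>) \<phi>" for \<mu>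
    by (simp add: fun_eq_iff shear_def G algebra_simps)
  show ?thesis
    unfolding shear
  \<comment> \<open>For \<open>\<bar>\<mu>\<bar> < 1\<close> the factor \<open>1 - \<mu>\<close> is positive, and it lies on the same side of 1 as \<open>- \<mu>\<close> of 0.\<close>
  proof (intro exI[of _ 1] conjI allI impI)
    fix \<mu> :: real assume "0 < \<mu> \<and> \<mu> < 1"
    then show "global_attractor (shear (1 - \<mu>) \<phi>)"
      by (intro global_attractor_shear cont lin) auto
  next
    fix \<mu> :: real assume \<mu>: "- 1 < \<mu> \<and> \<mu> < 0"
    then show "global_repellor (shear (1 - \<mu>) \<phi>)"
      by (intro global_repellor_shear cont lin) auto
  next
    fix \<mu> :: real assume "- 1 < \<mu> \<and> \<mu> < 1"
    then show "\<not> (\<exists>z. periodic_point (shear (1 - \<mu>) \<phi>) z)"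
      using no_periodic_point_shear[of "1 - \<mu>" \<phi>] \<phi>0 by simp
  qed simp
qed

end
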